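(* Let $s,p,\theta\in\mathbb{C}$ with $s\notin\mathbb{Z}$. Then for all $z\in\mathbb{C}\setminus\{0\}$ with $|z|<\frac1{|\theta|}$ and $\arg(1-\theta z),\arg z\in(-\pi,\pi)$, $$(1-\theta z)^p\,\Gamma(s,z)=\sum_{n=0}^\infty v_nz^n+\sum_{n=0}^\infty w_nz^{n+s},$$ with $v_n=\Gamma(s)\sum_{k=0}^n\frac{(-1)^ku_{n-k}}{k!}$ and $w_n=\frac{-1}{s}\sum_{k=0}^n\frac{(-1)^ku'_{n-k}}{k!}$, where $u_0=1$, $u_1=1-\theta p$, $u_2=\frac12\left(1-2\theta p+\theta^2(p-1)p\right)$, $u'_0=1$, $u'_1=\frac1{s+1}-\theta p$, $u'_2=\frac12\left(\frac{2}{(s+1)(s+2)}-\frac{2\theta p}{s+1}+\theta^2(p-1)p\right)$, and for all $n\ge2$ $$u_{n+1}=\beta_0(n)u_n+\beta_1(n)u_{n-1}+\beta_2(n)u_{n-2},\qquad u'_{n+1}=\beta'_0(n)u'_n+\beta'_1(n)u'_{n-1}+\beta'_2(n)u'_{n-2},$$ with \begin{align*} \beta_0(n)&=\frac{1-s+2\theta n(n-s)-\theta p(1-s+2n)+n}{(n+1)(1-s+n)},\\ \beta_1(n)&=\frac{\theta\left(-2(1-s)-\theta(n-p-1)(n-s-p-1)-2n+p+2\right)}{(n+1)(1-s+n)},\\ \beta_2(n)&=\frac{\theta^2(n-s-p-1)}{(n+1)(1-s+n)},\\ \beta'_0(n)&=\frac{1+2\theta n(s+n)-\theta p(s+1+2n)+n}{(n+1)(s+1+n)},\\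 \beta'_1(n)&=\frac{\theta\left(-2-\theta(n-p-1)(s+n-p-1)-2n+p+2\right)}{(n+1)(s+1+n)},\\ \beta'_2(n)&=\frac{\theta^2(1+n-p-2)}{(n+1)(s+1+n)}. \end{align*}
   Context: The upper incomplete gamma function is $\Gamma(s,z)=\int_z^\infty t^{s-1}e^{-t}\,dt$; equivalently $\Gamma(s,z)=e^{-z}U(1-s;1-s;z)$, where $U(a;b;z)=\frac{\Gamma(1-b)}{\Gamma(a+1-b)}M(a;b;z)+\frac{\Gamma(b-1)}{\Gamma(a)}z^{1-b}M(a+1-b;2-b;z)$ and $M(a;c;z)=\sum_{n=0}^\infty\frac{(a)_n}{(c)_n}\frac{z^n}{n!}$ with $(a)_n=a(a+1)\cdots(a+n-1)$, $(a)_0=1$. All powers are principal branches. When $\theta=0$, $1/|\theta|$ is read as $+\infty$. *)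

theory Defs
  imports "HOL-Analysis.Analysis"
begin

(* The principal branch of the upper incomplete gamma function, the integral of
   t^(s-1) e^(-t) from z to infinity, with the path taken to be the horizontal ray z + [0, \<infinity>).
   For z off the nonpositive real axis this ray stays in the domain of the principal power
   and the integral converges absolutely for every s. *)
definition upper_Gamma :: "complex \<Rightarrow> complex \<Rightarrow> complex" where
  "upper_Gamma s z =
     integral {0..} (\<lambda>x::real. (z + of_real x) powr (s - 1) * exp (- (z + of_real x)))"

(* The coefficient functions below take the index n as a complex number; they are only
   evaluated at of_nat n. *)
definition beta0 :: "complex \<Rightarrow> complex \<Rightarrow> complex \<Rightarrow> complex \<Rightarrow> complex" where
  "beta0 s p \<theta> n =
     (1 - s + 2 * \<theta> * n * (n - s) - \<theta> * p * (1 - s + 2 * n) + n)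
       / ((n + 1) * (1 - s + n))"

definition beta1 :: "complex \<Rightarrow> complex \<Rightarrow> complex \<Rightarrow> complex \<Rightarrow> complex" where
  "beta1 s p \<theta> n =
     (\<theta> * (- 2 * (1 - s) - \<theta> * (n - p - 1) * (n - s - p - 1) - 2 * n + p + 2))
       / ((n + 1) * (1 - s + n))"

definition beta2 :: "complex \<Rightarrow> complex \<Rightarrow> complex \<Rightarrow> complex \<Rightarrow> complex" where
  "beta2 s p \<theta> n = (\<theta>\<^sup>2 * (n - s - p - 1)) / ((n + 1) * (1 - s + n))"

definition beta0' :: "complex \<Rightarrow> complex \<Rightarrow> complex \<Rightarrow> complex \<Rightarrow> complex" where
  "beta0' s p \<theta> n =
     (1 + 2 * \<theta> * n * (s + n) - \<theta> * p * (s + 1 + 2 * n) + n)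
       / ((n + 1) * (s + 1 + n))"

definition beta1' :: "complex \<Rightarrow> complex \<Rightarrow> complex \<Rightarrow> complex \<Rightarrow> complex" where
  "beta1' s p \<theta> n =
     (\<theta> * (- 2 - \<theta> * (n - p - 1) * (s + n - p - 1) - 2 * n + p + 2))
       / ((n + 1) * (s + 1 + n))"

definition beta2' :: "complex \<Rightarrow> complex \<Rightarrow> complex \<Rightarrow> complex \<Rightarrow> complex" where
  "beta2' s p \<theta> n = (\<theta>\<^sup>2 * (1 + n - p - 2)) / ((n + 1) * (s + 1 + n))"

(* The last equation is the recurrence for u_(n+1) with n = m + 2. *)
fun u_coeff :: "complex \<Rightarrow> complex \<Rightarrow> complex \<Rightarrow> nat \<Rightarrow> complex" where
  "u_coeff s p \<theta> 0 = 1"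
| "u_coeff s p \<theta> (Suc 0) = 1 - \<theta> * p"
| "u_coeff s p \<theta> (Suc (Suc 0)) = 1 / 2 * (1 - 2 * \<theta> * p + \<theta>\<^sup>2 * (p - 1) * p)"
| "u_coeff s p \<theta> (Suc (Suc (Suc m))) =
     beta0 s p \<theta> (of_nat (m + 2)) * u_coeff s p \<theta> (Suc (Suc m))
   + beta1 s p \<theta> (of_nat (m + 2)) * u_coeff s p \<theta> (Suc m)
   + beta2 s p \<theta> (of_nat (m + 2)) * u_coeff s p \<theta> m"

fun u_coeff' :: "complex \<Rightarrow> complex \<Rightarrow> complex \<Rightarrow> nat \<Rightarrow> complex" where
  "u_coeff' s p \<theta> 0 = 1"
| "u_coeff' s p \<theta> (Suc 0) = 1 / (s + 1) - \<theta> * p"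
| "u_coeff' s p \<theta> (Suc (Suc 0)) =
     1 / 2 * (2 / ((s + 1) * (s + 2)) - 2 * \<theta> * p / (s + 1) + \<theta>\<^sup>2 * (p - 1) * p)"
| "u_coeff' s p \<theta> (Suc (Suc (Suc m))) =
     beta0' s p \<theta> (of_nat (m + 2)) * u_coeff' s p \<theta> (Suc (Suc m))
   + beta1' s p \<theta> (of_nat (m + 2)) * u_coeff' s p \<theta> (Suc m)
   + beta2' s p \<theta> (of_nat (m + 2)) * u_coeff' s p \<theta> m"

definition v_coeff :: "complex \<Rightarrow> complex \<Rightarrow> complex \<Rightarrow> nat \<Rightarrow> complex" where
  "v_coeff s p \<theta> n = Gamma s * (\<Sum>k=0..n. (- 1) ^ k * u_coeff s p \<theta> (n - k) / fact k)"

definition w_coeff :: "complex \<Rightarrow> complex \<Rightarrow> complex \<Rightarrow> nat \<Rightarrow> complex" where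
  "w_coeff s p \<theta> n = - 1 / s * (\<Sum>k=0..n. (- 1) ^ k * u_coeff' s p \<theta> (n - k) / fact k)"

end

theory Submission
  imports Defs "HOL-Real_Asymp.Real_Asymp"
begin

text \<open>
  Off the nonpositive real axis, and for \<open>s \<notin> \<int>\<close>, one has
  \<open>\<Gamma>(s, z) = \<Gamma>(s) - (z\<^sup>s / s) e\<^sup>-\<^sup>z M(1; s+1; z)\<close>, where \<open>M(1; s+1; z)\<close> is the entire function
  \<open>\<Sum>n. z^n / (s+1)\<^sub>n\<close>. Multiplying by \<open>A(z) = (1 - \<theta> z)\<^sup>p\<close> leaves two power series of radius at least
  \<open>1/\<bar>\<theta>\<bar>\<close>, the second one carrying the factor \<open>z\<^sup>s\<close>, and it remains to recognise their
  coefficients.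

  Coefficients. The numbers \<open>u\<^sub>n\<close> are the coefficients of \<open>A(z) e\<^sup>z\<close>, and \<open>u'\<^sub>n\<close> those of
  \<open>A(z) M(1; s+1; z)\<close>; the convolution with \<open>(-1)^k / k!\<close> in \<open>v\<^sub>n\<close> and \<open>w\<^sub>n\<close> is multiplication by
  \<open>e\<^sup>-\<^sup>z\<close>. Both \<open>e\<^sup>z = M(1-s; 1-s; z)\<close> and \<open>M(1; s+1; z)\<close> solve a Kummer equation
  \<open>z Y'' + (b - z) Y' = a Y\<close>. Substituting \<open>G = A Y\<close> and clearing denominators with \<open>(1 - \<theta> z)\<^sup>2\<close>
  gives a linear equation for \<open>G\<close> with polynomial coefficients. Comparing coefficients in it
  yields a single four-term recurrence in \<open>a\<close> and \<open>b\<close> (lemma \<open>binomial_times_kummer_recurrence\<close>) that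
  specialises to both of the given ones; the leading factors \<open>(n+1)(n+b)\<close> do not vanish because
  \<open>s\<close> is not an integer.

  Incomplete gamma function. The first-order equation \<open>z Y' + (s - z) Y = s\<close> for \<open>Y = M(1; s+1; z)\<close>
  says that the right-hand side above is an antiderivative of \<open>- z^(s-1) e\<^sup>-\<^sup>z\<close>. Hence the identity
  follows once this antiderivative is known to tend to \<open>0\<close> along every horizontal ray starting off the
  nonpositive axis (lemma \<open>kummer_Gamma_ray_tendsto_0\<close>). On the positive axis with \<open>Re s > 0\<close> this is Euler's integral for
  \<open>\<Gamma>(s)\<close>. Parallel rays have the same limit since the derivative decays exponentially, and the
  functional equation in \<open>s\<close> carries the result down to arbitrary non-integral \<open>s\<close>.
\<close>

section \<open>The recurrence for a product of a binomial and a Kummer series\<close>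

text \<open>
  The Taylor series of \<open>(1 - \<theta> z)\<^sup>p\<close> at \<open>0\<close>.
\<close>
definition binomial_series :: "complex \<Rightarrow> complex \<Rightarrow> complex fps" where
  "binomial_series p \<theta> = Abs_fps (\<lambda>n. (p gchoose n) * (- \<theta>) ^ n)"

lemma binomial_series_ODE:
  "(1 - fps_const \<theta> * fps_X) * fps_deriv (binomial_series p \<theta>) = - (fps_const \<theta> * fps_const p * binomial_series p \<theta>)"
proof (rule fps_ext)
  fix n
  have step: "of_nat (Suc k) * (p gchoose Suc k) = (p - of_nat k) * (p gchoose k)" for k
    using gbinomial_absorb_comp[of p k] gbinomial_absorption[of k p] by simp
  show "fps_nth ((1 - fps_const \<theta> * fps_X) * fps_deriv (binomial_series p \<theta>)) n
      = fps_nth (- (fps_const \<theta> * fps_const p * binomial_series p \<theta>)) n"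
  proof (cases n)
    case 0
    then show ?thesis by (simp add: binomial_series_def)
  next
    case (Suc k)
    have "fps_nth ((1 - fps_const \<theta> * fps_X) * fps_deriv (binomial_series p \<theta>)) (Suc k)
      = of_nat (Suc (Suc k)) * (p gchoose Suc (Suc k)) * (- \<theta>) ^ Suc (Suc k)
        - \<theta> * (of_nat (Suc k) * (p gchoose Suc k) * (- \<theta>) ^ Suc k)"
      by (simp add: binomial_series_def ring_distribs mult.assoc del: of_nat_Suc power_Suc)
    also have "\<dots> = - (\<theta> * p) * ((p gchoose Suc k) * (- \<theta>) ^ Suc k)"
      unfolding step[of "Suc k"] by (simp add: algebra_simps)
    finally show ?thesis using Suc by (simp add: binomial_series_def)
  qed
qed

text \<open>
  Since \<open>A = (1 - \<theta> z)\<^sup>p\<close> satisfies \<open>Q A' = -\<theta>pA\<close> with \<open>Q = 1 - \<theta> z\<close>, every derivative of \<open>Y = G/A\<close>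
  becomes, after multiplication by \<open>A Q\<^sup>2\<close>, a combination of derivatives of \<open>G\<close> with polynomial
  coefficients. Kummer's equation for \<open>Y\<close> thus turns into an equation of degree 3 in \<open>z\<close> for \<open>G\<close>,
  which relates four consecutive coefficients. The parameters \<open>a\<close> and \<open>b\<close> are kept general because
  both recurrences of the theorem are instances.
\<close>
lemma binomial_times_kummer_recurrence:
  fixes Y :: "complex fps" and a b \<theta> p :: complex
  assumes Y: "fps_X * fps_deriv (fps_deriv Y) + (fps_const b - fps_X) * fps_deriv Y
                = fps_const a * Y"
  defines "G \<equiv> binomial_series p \<theta> * Y"
  assumes n: "n = of_nat (m + 2)"
  shows "(n + 1) * (b + n) * fps_nth G (m + 3) =
      (a + 2 * \<theta> * n * (n + b - 1) - \<theta> * p * (b + 2 * n) + n) * fps_nth G (m + 2)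
    + \<theta> * (- 2 * a - \<theta> * (n - p - 1) * (n + b - p - 2) - 2 * n + p + 2) * fps_nth G (m + 1)
    + \<theta>\<^sup>2 * (n + a - p - 2) * fps_nth G m"
proof -
  define A where "A = binomial_series p \<theta>"
  define Q :: "complex fps" where "Q = 1 - fps_const \<theta> * fps_X"
  define t where "t = fps_const \<theta>"
  define P where "P = fps_const p"
  define B where "B = fps_const b"
  define C where "C = fps_const a"
  let ?D = "fps_deriv"
  have A1: "Q * ?D A = - (t * P * A)"
    using binomial_series_ODE[of \<theta> p] by (simp only: A_def Q_def t_def P_def)
  have dQ: "?D Q = - t" "?D t = 0" "?D P = 0" by (simp_all add: Q_def t_def P_def)
  have "?D (Q * ?D A) = ?D (- (t * P * A))" by (simp only: A1)
  then have "Q * ?D (?D A) - t * ?D A = - (t * P * ?D A)"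
    by (simp add: dQ)
  then have "Q * ?D (?D A) = t * (1 - P) * ?D A"
    by (simp add: algebra_simps)
  then have "Q * (Q * ?D (?D A)) = Q * (t * (1 - P) * ?D A)"
    by (simp only:)
  also have "\<dots> = t * (1 - P) * (Q * ?D A)"
    by (simp add: algebra_simps)
  finally have A2: "Q * (Q * ?D (?D A)) = - (t * (1 - P) * (t * P * A))"
    by (simp add: A1)
  have Y': "fps_X * ?D (?D Y) + (B - fps_X) * ?D Y - C * Y = 0"
    using Y by (simp add: B_def C_def)
  have G: "G = A * Y" by (simp add: G_def A_def)
  have G1: "?D G = ?D A * Y + A * ?D Y" by (simp add: G algebra_simps)
  have G2: "?D (?D G) = ?D (?D A) * Y + 2 * ?D A * ?D Y + A * ?D (?D Y)"
    by (simp add: G1 algebra_simps)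
  \<comment> \<open>From \<open>A' = -\<theta>pA/Q\<close> one gets \<open>Q A Y' = Q G' + \<theta>pG\<close> and
    \<open>Q\<^sup>2 A Y'' = Q\<^sup>2 G'' + 2\<theta>pQ G' + \<theta>\<^sup>2p(p+1) G\<close>; the equation below is \<open>Q\<^sup>2 A\<close> times
    the Kummer equation with these substitutions.\<close>
  have ODE: "fps_X * (Q * Q * ?D (?D G) + 2 * t * P * Q * ?D G + t * t * P * (P + 1) * G)
      + (B - fps_X) * Q * (Q * ?D G + t * P * G) - C * (Q * Q * G) = 0"
    (is "?L = 0")
  proof -
    \<comment> \<open>an explicit combination of the three equations \<open>Y'\<close>, \<open>A1\<close> and \<open>A2\<close>\<close>
    have "?L = Q * Q * A * (fps_X * ?D (?D Y) + (B - fps_X) * ?D Y - C * Y)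
      + fps_X * Y * (Q * (Q * ?D (?D A)) + t * (1 - P) * (t * P * A))
      + (Q * ?D A + t * P * A) * (2 * fps_X * (Q * ?D Y + t * P * Y) + (B - fps_X) * Q * Y)"
      unfolding G2 G1 unfolding G by (simp add: algebra_simps)
    also have "\<dots> = 0" by (simp add: A1 A2 Y')
    finally show ?thesis .
  qed
  have c: "fps_const (x * y) = fps_const x * fps_const y" "fps_const (x + y) = fps_const x + fps_const y"
     "fps_const (x - y) = fps_const x - fps_const y" "fps_const (x ^ k) = fps_const x ^ k"
     "fps_const 1 = 1" "fps_const 2 = 2" for x y :: complex and k
    by (simp_all add: numeral_fps_const fps_const_power)
  \<comment> \<open>The same operator sorted by \<open>X^j D^i\<close>, so that coefficients can be read off termwise.\<close>
  have "?L = fps_X ^ 1 * ?D (?D G) - fps_const (2 * \<theta>) * (fps_X ^ 2 * ?D (?D G))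
     + fps_const (\<theta>^2) * (fps_X ^ 3 * ?D (?D G))
     + fps_const b * ?D G + fps_const (2 * \<theta> * p - 2 * b * \<theta> - 1) * (fps_X ^ 1 * ?D G)
     + fps_const (b * \<theta>^2 + 2 * \<theta> - 2 * \<theta>^2 * p) * (fps_X ^ 2 * ?D G)
     - fps_const (\<theta>^2) * (fps_X ^ 3 * ?D G)
     + fps_const (\<theta> * p * b - a) * G
     + fps_const (\<theta>^2 * p * (p + 1) - \<theta> * p * (1 + b * \<theta>) + 2 * a * \<theta>) * (fps_X ^ 1 * G)
     + fps_const (\<theta>^2 * p - a * \<theta>^2) * (fps_X ^ 2 * G)" (is "_ = ?R")
    unfolding c t_def[symmetric] P_def[symmetric] B_def[symmetric] C_def[symmetric] Q_def
    by (simp add: algebra_simps power2_eq_square power3_eq_cube)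
  with ODE have "fps_nth ?R (m + 2) = 0" by simp
  \<comment> \<open>For \<open>m = 0\<close> neither \<open>X\<^sup>3 G''\<close> nor \<open>X\<^sup>3 G'\<close> has a term of degree 2; the factor \<open>n - 2\<close> covers this case.\<close>
  then have "(n + 1) * n * fps_nth G (m + 3) - 2 * \<theta> * (n * (n - 1) * fps_nth G (m + 2))
     + \<theta>^2 * ((n - 1) * (n - 2) * fps_nth G (m + 1))
     + b * ((n + 1) * fps_nth G (m + 3)) + (2 * \<theta> * p - 2 * b * \<theta> - 1) * (n * fps_nth G (m + 2))
     + (b * \<theta>^2 + 2 * \<theta> - 2 * \<theta>^2 * p) * ((n - 1) * fps_nth G (m + 1))
     - \<theta>^2 * ((n - 2) * fps_nth G m)
     + (\<theta> * p * b - a) * fps_nth G (m + 2)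
     + (\<theta>^2 * p * (p + 1) - \<theta> * p * (1 + b * \<theta>) + 2 * a * \<theta>) * fps_nth G (m + 1)
     + (\<theta>^2 * p - a * \<theta>^2) * fps_nth G m = 0"
    unfolding fps_add_nth fps_sub_nth fps_mult_left_const_nth fps_X_power_mult_nth fps_deriv_nth n
    by (cases m) (simp_all add: numeral_eq_Suc algebra_simps)
  then show ?thesis by algebra
qed

text \<open>
  The identity \<open>e\<^sup>z = M(b; b; z)\<close> in differential form; \<open>b\<close> stays free so that it can be matched with the
  denominators \<open>1 - s + n\<close> of the recurrence.
\<close>
lemma exp_Kummer_ODE:
  "fps_X * fps_deriv (fps_deriv (fps_exp 1)) + (fps_const b - fps_X) * fps_deriv (fps_exp 1)
     = fps_const b * fps_exp (1 :: complex)"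
  by (simp add: algebra_simps)

section \<open>The entire function M(1; s+1; z)\<close>

text \<open>
  The series of \<open>M(1; s+1; z)\<close>: here \<open>(1)\<^sub>n\<close> cancels \<open>n!\<close>.
\<close>
definition kummer_series :: "complex \<Rightarrow> complex fps" where
  "kummer_series s = Abs_fps (\<lambda>n. 1 / pochhammer (s + 1) n)"

lemma nonint_plus_nat_nonzero:
  assumes "s \<notin> \<int>"
  shows "s + of_nat n \<noteq> (0::complex)" "s + 1 + of_nat n \<noteq> (0::complex)"
proof -
  have "s + of_nat k \<notin> \<int>" for k
    using assms Ints_diff[of "s + of_nat k" "of_nat k"] by auto
  from this[of n] this[of "Suc n"] show "s + of_nat n \<noteq> 0" "s + 1 + of_nat n \<noteq> 0"
    by (metis Ints_0, metis Ints_0 add.assoc of_nat_Suc)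
qed

lemma kummer_series_rec:
  assumes "s \<notin> \<int>"
  shows "(s + 1 + of_nat n) * fps_nth (kummer_series s) (Suc n) = fps_nth (kummer_series s) n"
  using nonint_plus_nat_nonzero[OF assms, of n]
  by (simp add: kummer_series_def pochhammer_Suc divide_simps)

lemma kummer_series_conv_radius:
  assumes s: "s \<notin> \<int>"
  shows "fps_conv_radius (kummer_series s) = \<infinity>"
  unfolding fps_conv_radius_def
proof (rule conv_radius_ratio_limit_ereal_nonzero)
  have nz: "fps_nth (kummer_series s) n \<noteq> 0" for n
    using nonint_plus_nat_nonzero(2)[OF s] by (force simp: kummer_series_def pochhammer_eq_0_iff add_eq_0_iff2)
  have "norm (fps_nth (kummer_series s) n) / norm (fps_nth (kummer_series s) (Suc n)) = norm (s + 1 + of_nat n)" for n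
    using kummer_series_rec[OF s, of n] nz[of "Suc n"] by (metis nonzero_mult_div_cancel_right norm_divide)
  moreover have "filterlim (\<lambda>n. norm (s + 1 + of_nat n)) at_top sequentially"
    by (intro filterlim_at_infinity_imp_norm_at_top tendsto_add_filterlim_at_infinity[OF tendsto_const] tendsto_of_nat)
  ultimately show "(\<lambda>n. ereal (norm (fps_nth (kummer_series s) n) / norm (fps_nth (kummer_series s) (Suc n)))) \<longlonglongrightarrow> \<infinity>"
    by (simp add: tendsto_PInfty_eq_at_top)
qed simp

text \<open>
  An integrated form of Kummer's equation: when its first parameter is \<open>1\<close>, the expression
  \<open>z Y'' + (s+1 - z) Y' - Y\<close> is the derivative of \<open>z Y' + (s - z) Y\<close>, which is therefore constant.
\<close>
lemma kummer_series_ODE: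
  assumes s: "s \<notin> \<int>"
  shows "fps_X * fps_deriv (kummer_series s) + (fps_const s - fps_X) * kummer_series s = fps_const s"
proof (rule fps_ext)
  fix n
  show "fps_nth (fps_X * fps_deriv (kummer_series s) + (fps_const s - fps_X) * kummer_series s) n = fps_nth (fps_const s) n"
  proof (cases n)
    case 0
    then show ?thesis by (simp add: kummer_series_def)
  next
    case (Suc k)
    then show ?thesis using kummer_series_rec[OF s, of k] by (simp add: algebra_simps)
  qed
qed

text \<open>
  Differentiating the first-order equation of \<open>M(1; s+1; z)\<close> removes its constant right-hand side, which leaves
  the homogeneous equation that the recurrence lemma expects.
\<close>
lemma Kummer_ODE_of_first_order:
  assumes "fps_X * fps_deriv Y + (fps_const s - fps_X) * Y = fps_const (s :: complex)"
  shows "fps_X * fps_deriv (fps_deriv Y) + (fps_const (s + 1) - fps_X) * fps_deriv Y = fps_const 1 * Y"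
proof -
  have "fps_deriv (fps_X * fps_deriv Y + (fps_const s - fps_X) * Y) = 0"
    unfolding assms by simp
  then show ?thesis by (simp add: algebra_simps flip: fps_const_add)
qed

lemma kummer_series_eval_ODE:
  assumes s: "s \<notin> \<int>"
  shows "z * eval_fps (fps_deriv (kummer_series s)) z + (s - z) * eval_fps (kummer_series s) z = s"
proof -
  let ?Y = "kummer_series s"
  have r: "fps_conv_radius ?Y = \<infinity>" "fps_conv_radius (fps_deriv ?Y) = \<infinity>"
    using kummer_series_conv_radius[OF s] fps_conv_radius_deriv[of ?Y] by auto
  have q: "fps_conv_radius (fps_const s - fps_X) = \<infinity>"
    using fps_conv_radius_diff[of "fps_const s" fps_X] by simp
  have p: "fps_conv_radius (fps_X * fps_deriv ?Y) = \<infinity>" "fps_conv_radius ((fps_const s - fps_X) * ?Y) = \<infinity>"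
    using fps_conv_radius_mult[of fps_X "fps_deriv ?Y"] fps_conv_radius_mult[of "fps_const s - fps_X" ?Y] by (simp_all add: r q)
  have "eval_fps (fps_X * fps_deriv ?Y + (fps_const s - fps_X) * ?Y) z =
    z * eval_fps (fps_deriv ?Y) z + (s - z) * eval_fps ?Y z"
    by (simp add: eval_fps_add eval_fps_mult eval_fps_diff r q p)
  then show ?thesis unfolding kummer_series_ODE[OF s] by simp
qed

text \<open>
  From \<open>(s+1)\<^sub>n\<^sub>+\<^sub>1 = (s+1) (s+2)\<^sub>n\<close>; this contiguity relation is what the functional equation of the
  incomplete gamma function amounts to.
\<close>
lemma kummer_series_shift:
  assumes s: "s \<notin> \<int>"
  shows "z * eval_fps (kummer_series (s + 1)) z = (s + 1) * (eval_fps (kummer_series s) z - 1)"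
proof -
  have s1: "s + 1 \<notin> \<int>" using s by (metis Ints_1 Ints_diff add_diff_cancel_right')
  have "(s + 1) * fps_nth (kummer_series s) (Suc n) = fps_nth (kummer_series (s + 1)) n" for n
    using nonint_plus_nat_nonzero(2)[OF s, of 0] by (simp add: kummer_series_def pochhammer_rec)
  then have 1: "fps_nth (kummer_series (s + 1)) n * z ^ n = (s + 1) * (fps_nth (kummer_series s) (Suc n) * z ^ n)" for n
    by (metis mult.assoc)
  have sm: "(\<lambda>n. fps_nth (kummer_series s) n * z ^ n) sums eval_fps (kummer_series s) z"
    by (intro sums_eval_fps) (simp add: kummer_series_conv_radius[OF s])
  have "(\<lambda>n. (s + 1) * (fps_nth (kummer_series s) (Suc n) * z ^ Suc n)) sums ((s + 1) * (eval_fps (kummer_series s) z - 1))"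
    using sm by (intro sums_mult) (subst sums_Suc_iff, simp add: kummer_series_def)
  moreover have "(\<lambda>n. z * (fps_nth (kummer_series (s + 1)) n * z ^ n)) sums (z * eval_fps (kummer_series (s + 1)) z)"
    by (intro sums_mult sums_eval_fps) (simp add: kummer_series_conv_radius[OF s1])
  moreover have "(\<lambda>n. (s + 1) * (fps_nth (kummer_series s) (Suc n) * z ^ Suc n)) = (\<lambda>n. z * (fps_nth (kummer_series (s + 1)) n * z ^ n))"
    unfolding 1 by (simp add: mult_ac)
  ultimately show ?thesis using sums_unique2 by metis
qed

section \<open>Generating functions of the given coefficients\<close>

text \<open>
  The parameters here are \<open>a = b = 1 - s\<close>. The recurrence mentions \<open>s\<close>, although the
  generating function does not, because it is derived from \<open>e\<^sup>z = M(1-s; 1-s; z)\<close>.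
\<close>
lemma u_coeff_eq:
  assumes s: "s \<notin> \<int>"
  shows "u_coeff s p \<theta> n = fps_nth (binomial_series p \<theta> * fps_exp 1) n"
  using s
proof (induction s p \<theta> n rule: u_coeff.induct)
  case (1 s p \<theta>)
  then show ?case by (simp add: binomial_series_def)
next
  case (2 s p \<theta>)
  then show ?case by (simp add: binomial_series_def fps_mult_nth)
next
  case (3 s p \<theta>)
  then show ?case
    by (simp add: binomial_series_def fps_mult_nth numeral_2_eq_2 gbinomial_Suc field_simps)
next
  case (4 s p \<theta> m)
  let ?n = "of_nat (m + 2) :: complex"
  have "?n + 1 \<noteq> 0" by (metis of_nat_Suc add.commute of_nat_neq_0)
  moreover have "1 - s + ?n \<noteq> 0" using 4 by (metis Ints_1 Ints_add Ints_of_nat add_diff_eq diff_add_cancel eq_iff_diff_eq_0 add.commute)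
  moreover note binomial_times_kummer_recurrence[OF exp_Kummer_ODE[of "1 - s"], of ?n m p \<theta>]
  ultimately show ?case using 4
    by (simp add: beta0_def beta1_def beta2_def divide_simps numeral_eq_Suc)
       (simp add: algebra_simps)
qed

text \<open>
  The parameters here are \<open>a = 1\<close> and \<open>b = s + 1\<close>.
\<close>
lemma u_coeff'_eq:
  assumes s: "s \<notin> \<int>"
  shows "u_coeff' s p \<theta> n = fps_nth (binomial_series p \<theta> * kummer_series s) n"
  using s
proof (induction s p \<theta> n rule: u_coeff'.induct)
  case (1 s p \<theta>)
  then show ?case by (simp add: binomial_series_def kummer_series_def)
next
  case (2 s p \<theta>)
  then show ?case by (simp add: binomial_series_def kummer_series_def fps_mult_nth)
next
  case (3 s p \<theta>)
  have "pochhammer (s + 1) (Suc (Suc 0)) = (s + 1) * (s + 2)"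
    by (simp add: pochhammer_Suc add.assoc)
  then have "fps_nth (kummer_series s) (Suc (Suc 0)) = 1 / ((s + 1) * (s + 2))"
    "fps_nth (kummer_series s) (Suc 0) = 1 / (s + 1)" "fps_nth (kummer_series s) 0 = 1"
    by (simp_all add: kummer_series_def)
  moreover have "fps_nth (binomial_series p \<theta>) (Suc (Suc 0)) = \<theta>\<^sup>2 * (p - 1) * p / 2"
    "fps_nth (binomial_series p \<theta>) (Suc 0) = - (\<theta> * p)" "fps_nth (binomial_series p \<theta>) 0 = 1"
    by (simp_all add: binomial_series_def gbinomial_Suc power2_eq_square field_simps)
  ultimately show ?case
    by (simp add: fps_mult_nth algebra_simps add_divide_distrib diff_divide_distrib)
next
  case (4 s p \<theta> m)
  let ?n = "of_nat (m + 2) :: complex"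
  have "?n + 1 \<noteq> 0" by (metis of_nat_Suc add.commute of_nat_neq_0)
  moreover have "s + 1 + ?n \<noteq> 0" using nonint_plus_nat_nonzero(2)[OF 4(4)] by blast
  moreover note binomial_times_kummer_recurrence[OF Kummer_ODE_of_first_order[OF kummer_series_ODE[of s]], of ?n m p \<theta>]
  ultimately show ?case using 4
    by (simp add: beta0'_def beta1'_def beta2'_def divide_simps numeral_eq_Suc)
       (simp add: algebra_simps)
qed

text \<open>
  The convolutions defining \<open>v\<^sub>n\<close> and \<open>w\<^sub>n\<close> multiply the generating functions by \<open>e\<^sup>-\<^sup>z\<close>, which cancels the
  factor \<open>e\<^sup>z\<close> in the first of them.
\<close>
lemma v_coeff_eq:
  assumes s: "s \<notin> \<int>"
  shows "v_coeff s p \<theta> n = Gamma s * fps_nth (binomial_series p \<theta>) n"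
proof -
  have "(\<Sum>k=0..n. (- 1) ^ k * u_coeff s p \<theta> (n - k) / fact k)
      = fps_nth (fps_exp (- 1) * (binomial_series p \<theta> * fps_exp 1)) n"
    by (simp add: fps_mult_nth[of "fps_exp (- 1)"] u_coeff_eq[OF s])
  also have "fps_exp (- 1) * (binomial_series p \<theta> * fps_exp 1)
      = binomial_series p \<theta> * (fps_exp (- 1) * fps_exp 1)"
    by (simp add: mult_ac)
  also have "fps_exp (- 1) * fps_exp (1 :: complex) = 1"
    by (simp flip: fps_exp_add_mult)
  finally show ?thesis by (simp add: v_coeff_def)
qed

lemma w_coeff_eq:
  assumes s: "s \<notin> \<int>"
  shows "w_coeff s p \<theta> n = - 1 / s * fps_nth (fps_exp (- 1) * (binomial_series p \<theta> * kummer_series s)) n"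
  by (simp add: w_coeff_def fps_mult_nth[of "fps_exp (- 1)"] u_coeff'_eq[OF s])

lemma binomial_series_disc:
  assumes "\<theta> = 0 \<or> norm z < 1 / norm \<theta>"
  shows "norm z < fps_conv_radius (binomial_series p \<theta>)"
    and "eval_fps (binomial_series p \<theta>) z = (1 - \<theta> * z) powr p"
proof -
  have sums: "(\<lambda>n. fps_nth (binomial_series p \<theta>) n * w ^ n) sums (1 - \<theta> * w) powr p"
    if "norm (\<theta> * w) < 1" for w
    using gen_binomial_complex[of "- (\<theta> * w)" p] that
    by (simp add: binomial_series_def power_mult_distrib[of "- \<theta>" w, simplified] mult.assoc)
  \<comment> \<open>The binomial series converges at a point slightly further out than \<open>z\<close>, so \<open>z\<close> is inside its disc.\<close>
  obtain r where r: "norm z < r" "norm \<theta> * r < 1"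
  proof (cases "\<theta> = 0")
    case True
    then show ?thesis using that[of "norm z + 1"] by simp
  next
    case False
    then obtain r where "norm z < r" "r < 1 / norm \<theta>"
      using assms dense by blast
    then show ?thesis using that[of r] False by (simp add: field_simps)
  qed
  have r0: "r > 0" using r(1) norm_ge_zero[of z] by linarith
  then have "norm (\<theta> * of_real r) < 1" using r(2) by (simp add: norm_mult)
  from conv_radius_geI[OF sums_summable[OF sums[OF this]]] r0
  have "fps_conv_radius (binomial_series p \<theta>) \<ge> r" by (simp add: fps_conv_radius_def)
  with r(1) show "norm z < fps_conv_radius (binomial_series p \<theta>)"
    by (meson ereal_less_eq(3) less_ereal.simps(1) order_less_le_trans)
  have "norm (\<theta> * z) \<le> norm \<theta> * r"
    using r(1) by (simp add: norm_mult mult_left_mono)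
  then have "norm (\<theta> * z) < 1" using r(2) by linarith
  from sums_unique[OF sums[OF this]] show "eval_fps (binomial_series p \<theta>) z = (1 - \<theta> * z) powr p"
    by (simp add: eval_fps_def)
qed

section \<open>The incomplete gamma function\<close>

text \<open>
  The closed form of \<open>\<Gamma>(s, z)\<close> that is to be matched with its integral: the complete gamma function
  minus the lower incomplete one, the latter expanded at \<open>0\<close>.
\<close>
definition kummer_Gamma :: "complex \<Rightarrow> complex \<Rightarrow> complex" where
  "kummer_Gamma s z = Gamma s - z powr s / s * exp (- z) * eval_fps (kummer_series s) z"

text \<open>
  The functional equation that integration by parts gives for \<open>\<Gamma>(s, z)\<close>. For the closed form, whose behaviour
  at infinity is not yet known, it comes from \<open>\<Gamma>(s+1) = s \<Gamma>(s)\<close> and the contiguity relation of the series.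
\<close>
lemma kummer_Gamma_plus1:
  assumes s: "s \<notin> \<int>" and z: "z \<noteq> 0"
  shows "kummer_Gamma (s + 1) z = s * kummer_Gamma s z + z powr s * exp (- z)"
proof -
  have nz: "s \<noteq> 0" "s + 1 \<noteq> 0" using nonint_plus_nat_nonzero[OF s, of 0] by auto
  have "s \<notin> \<int>\<^sub>\<le>\<^sub>0" using s nonpos_Ints_Int by blast
  then have G: "Gamma (s + 1) = s * Gamma s" by (simp add: Gamma_plus1)
  have "z powr (s + 1) / (s + 1) * exp (- z) * eval_fps (kummer_series (s + 1)) z
     = z powr s / (s + 1) * exp (- z) * (z * eval_fps (kummer_series (s + 1)) z)"
    using z by (simp add: powr_add)
  also have "\<dots> = z powr s * exp (- z) * (eval_fps (kummer_series s) z - 1)"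
    unfolding kummer_series_shift[OF s] using nz by simp
  finally show ?thesis unfolding kummer_Gamma_def G using nz by (simp add: algebra_simps)
qed

text \<open>
  The first-order equation of \<open>M(1; s+1; z)\<close> is exactly what collapses the three terms of the product rule to one.
\<close>
lemma kummer_Gamma_deriv:
  assumes s: "s \<notin> \<int>" and z: "z \<notin> \<real>\<^sub>\<le>\<^sub>0"
  shows "(kummer_Gamma s has_field_derivative - (z powr (s - 1) * exp (- z))) (at z within S)"
proof -
  let ?Y = "eval_fps (kummer_series s)" and ?Y' = "eval_fps (fps_deriv (kummer_series s))"
  have z0: "z \<noteq> 0" using z by auto
  have s0: "s \<noteq> 0" using s by auto
  have dY: "(?Y has_field_derivative ?Y' z) (at z within S)"
    by (intro has_field_derivative_eval_fps) (simp add: kummer_series_conv_radius[OF s])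
  have "(kummer_Gamma s has_field_derivative
    - ((s * z powr (s - 1)) / s * exp (- z) * ?Y z - z powr s / s * exp (- z) * ?Y z
        + z powr s / s * exp (- z) * ?Y' z)) (at z within S)"
    unfolding kummer_Gamma_def[abs_def]
    by (rule derivative_eq_intros dY refl z | simp add: s0)+
       (simp add: algebra_simps s0)?
  also have "z powr s = z * z powr (s - 1)" using z0 by (simp add: powr_diff)
  also have "(s * z powr (s - 1)) / s * exp (- z) * ?Y z - z * z powr (s - 1) / s * exp (- z) * ?Y z
        + z * z powr (s - 1) / s * exp (- z) * ?Y' z
      = z powr (s - 1) * exp (- z) * (z * ?Y' z + (s - z) * ?Y z) / s"
    using s0 by (simp add: field_simps)
  also have "\<dots> = z powr (s - 1) * exp (- z)"
    unfolding kummer_series_eval_ODE[OF s] using s0 by simp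
  finally show ?thesis .
qed

lemma shift_notin_nonpos_Reals:
  fixes z :: complex
  assumes "z \<notin> \<real>\<^sub>\<le>\<^sub>0" "x \<ge> 0"
  shows "z + of_real x \<notin> \<real>\<^sub>\<le>\<^sub>0"
  using assms by (auto simp: complex_nonpos_Reals_iff complex_eq_iff)

lemma kummer_Gamma_has_integral_ray:
  assumes s: "s \<notin> \<int>" and z: "z \<notin> \<real>\<^sub>\<le>\<^sub>0" and T: "T \<ge> 0"
  shows "((\<lambda>x. (z + of_real x) powr (s - 1) * exp (- (z + of_real x))) has_integral
            (kummer_Gamma s z - kummer_Gamma s (z + of_real T))) {0..T}"
proof -
  have "((\<lambda>x. - ((z + of_real x) powr (s - 1) * exp (- (z + of_real x)))) has_integral
            (kummer_Gamma s (z + of_real T) - kummer_Gamma s (z + of_real 0))) {0..T}"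
  proof (rule fundamental_theorem_of_calculus[OF T])
    fix x assume x: "x \<in> {0..T}"
    have "((\<lambda>x. z + of_real x) has_vector_derivative 1) (at x within {0..T})"
      by (auto intro!: derivative_eq_intros)
    from field_vector_diff_chain_within[OF this, of "kummer_Gamma s"]
    show "((\<lambda>x. kummer_Gamma s (z + complex_of_real x)) has_vector_derivative
          - ((z + complex_of_real x) powr (s - 1) * exp (- (z + complex_of_real x)))) (at x within {0..T})"
      using kummer_Gamma_deriv[OF s shift_notin_nonpos_Reals[OF z], of x] x by (simp add: o_def)
  qed
  from has_integral_neg[OF this] show ?thesis by simp
qed

text \<open>
  Dominated convergence for truncations, applied once to Euler's integral and once to the integral along a ray.
\<close>
lemma tendsto_integral_half_line:
  fixes f :: "real \<Rightarrow> complex"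
  assumes F: "\<And>n::nat. (f has_integral F n) {0..real n}"
    and h: "h integrable_on {0..}"
    and le: "\<And>x. x \<ge> 0 \<Longrightarrow> norm (f x) \<le> h x"
  shows "F \<longlonglongrightarrow> integral {0..} f"
proof -
  let ?f = "\<lambda>n x. if x \<in> {0..real n} then f x else 0"
  have int: "(?f n has_integral F n) {0..}" for n
    using F[of n] by (subst has_integral_restrict) auto
  have "(\<lambda>n. integral {0..} (?f n)) \<longlonglongrightarrow> integral {0..} f"
  proof (rule dominated_convergence(2)[OF _ h])
    show "?f n integrable_on {0..}" for n using int by blast
    show "norm (?f n x) \<le> h x" if "x \<in> {0..}" for n x
      using le[of x] that norm_ge_zero[of "f x"] by (auto simp: order_trans[OF norm_ge_zero])
    fix x :: real assume x: "x \<in> {0..}"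
    have "eventually (\<lambda>n. ?f n x = f x) sequentially"
      using eventually_ge_at_top[of "nat \<lceil>x\<rceil>"] by eventually_elim (use x in \<open>auto simp: nat_le_iff ceiling_le_iff\<close>)
    then show "(\<lambda>n. ?f n x) \<longlonglongrightarrow> f x" by (rule tendsto_eventually)
  qed
  then show ?thesis using int[THEN integral_unique] by simp
qed

text \<open>
  Along \<open>w + x\<close> the argument stays bounded and the modulus lies between \<open>1\<close> and \<open>2 x\<close>, so only the factor
  \<open>e\<^sup>-\<^sup>x\<close> matters. The bound is uniform in \<open>w\<close> on a disc, which allows passing from one ray to
  another, and the absolute value around \<open>Re a\<close> covers both signs of the exponent.
\<close>
lemma Gamma_integrand_bound:
  assumes "norm w \<le> r" "x \<ge> r + 1"
  shows "norm ((w + of_real x) powr a * exp (- (w + of_real x)))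
     \<le> exp (pi * \<bar>Im a\<bar> + r) * ((2 * x) powr \<bar>Re a\<bar> * exp (- x))"
proof -
  have r: "r \<ge> 0" using assms(1) norm_ge_zero order_trans by blast
  let ?v = "w + of_real x"
  have v1: "norm ?v \<ge> 1" using norm_diff_ineq[of "of_real x" w] assms r by (simp add: add.commute)
  have v2: "norm ?v \<le> 2 * x" using norm_triangle_ineq[of w "of_real x"] assms r by simp
  have "norm ?v powr Re a \<le> norm ?v powr \<bar>Re a\<bar>" using v1 by (intro powr_mono) auto
  also have "\<dots> \<le> (2 * x) powr \<bar>Re a\<bar>" using v2 by (intro powr_mono2) auto
  finally have 1: "norm ?v powr Re a \<le> (2 * x) powr \<bar>Re a\<bar>" .
  have "- Im a * Arg ?v \<le> \<bar>Im a\<bar> * \<bar>Arg ?v\<bar>"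
    by (metis abs_ge_self abs_mult abs_minus_cancel)
  also have "\<dots> \<le> pi * \<bar>Im a\<bar>"
    using Arg_bounded[of ?v] by (subst mult.commute, intro mult_right_mono) (auto simp: abs_le_iff)
  finally have 2: "exp (- Im a * Arg ?v) \<le> exp (pi * \<bar>Im a\<bar>)" by simp
  have "\<bar>Re w\<bar> \<le> r" using abs_Re_le_cmod[of w] assms(1) by linarith
  then have 3: "exp (- Re ?v) \<le> exp r * exp (- x)" by (simp add: exp_add[symmetric])
  have "norm (?v powr a * exp (- ?v)) = norm ?v powr Re a * exp (- Im a * Arg ?v) * exp (- Re ?v)"
    by (simp add: norm_mult norm_powr_complex)
  also have "\<dots> \<le> (2 * x) powr \<bar>Re a\<bar> * exp (pi * \<bar>Im a\<bar>) * (exp r * exp (- x))"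
    by (intro mult_mono 1 2 3) auto
  finally show ?thesis by (simp add: exp_add mult_ac)
qed

lemma powr_exp_tendsto_0:
  assumes "c > 0"
  shows "((\<lambda>x::real. C * ((2 * x) powr k * exp (- (c * x)))) \<longlongrightarrow> 0) at_top"
proof (rule tendsto_mult_right_zero)
  show "((\<lambda>x::real. (2 * x) powr k * exp (- (c * x))) \<longlongrightarrow> 0) at_top"
    using assms by real_asymp
qed

lemma powr_exp_ray_tendsto_0:
  "(\<lambda>n. (z + of_nat n) powr a * exp (- (z + of_nat n))) \<longlonglongrightarrow> (0::complex)"
proof (rule Lim_null_comparison)
  let ?g = "\<lambda>x::real. exp (pi * \<bar>Im a\<bar> + norm z) * ((2 * x) powr \<bar>Re a\<bar> * exp (- x))"
  show "(\<lambda>n. ?g (real n)) \<longlonglongrightarrow> 0"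
    by (rule filterlim_compose[OF powr_exp_tendsto_0[of 1, simplified] filterlim_real_sequentially])
  show "\<forall>\<^sub>F n in sequentially. norm ((z + of_nat n) powr a * exp (- (z + of_nat n))) \<le> ?g (real n)"
    using eventually_ge_at_top[of "nat \<lceil>norm z + 1\<rceil>"]
  proof eventually_elim
    case (elim n)
    then have "real n \<ge> norm z + 1" by linarith
    from Gamma_integrand_bound[OF order_refl this, of a] show ?case by simp
  qed
qed

text \<open>
  For \<open>Re s > 0\<close> the antiderivative extends continuously to \<open>0\<close> with value \<open>\<Gamma>(s)\<close>, so its value at \<open>n\<close> is the
  tail of Euler's integral.
\<close>
lemma kummer_Gamma_real_tendsto_0:
  assumes s: "s \<notin> \<int>" and pos: "Re s > 0"
  shows "(\<lambda>n. kummer_Gamma s (of_nat n)) \<longlonglongrightarrow> 0"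
proof -
  let ?f = "\<lambda>t::real. of_real t powr (s - 1) * exp (- of_real t)"
  have F: "(?f has_integral (Gamma s - kummer_Gamma s (of_nat n))) {0..real n}" for n
  proof -
    have 1: "((\<lambda>x. - ?f x) has_integral (kummer_Gamma s (of_real (real n)) - kummer_Gamma s (of_real 0))) {0..real n}"
    proof (rule fundamental_theorem_of_calculus_interior)
      show "continuous_on {0..real n} (\<lambda>x. kummer_Gamma s (of_real x))"
        unfolding kummer_Gamma_def using pos s
        by (auto intro!: continuous_intros simp: kummer_series_conv_radius[OF s] complex_nonneg_Reals_iff)
      fix x assume x: "x \<in> {0<..<real n}"
      have "(of_real has_vector_derivative 1) (at x within UNIV)"
        by (auto intro!: derivative_eq_intros)
      from field_vector_diff_chain_within[OF this, of "kummer_Gamma s"]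
      show "((\<lambda>x. kummer_Gamma s (complex_of_real x)) has_vector_derivative - ?f x) (at x)"
        using kummer_Gamma_deriv[OF s, of "of_real x"] x by (simp add: o_def)
    qed auto
    have "kummer_Gamma s 0 = Gamma s" by (simp add: kummer_Gamma_def)
    with has_integral_neg[OF 1] show ?thesis by simp
  qed
  have eq: "?f = (\<lambda>t. of_real t powr (s - 1) / of_real (exp t))"
    by (simp add: exp_minus exp_of_real divide_inverse fun_eq_iff)
  have I: "integral {0..} ?f = Gamma s"
    unfolding eq by (rule integral_unique[OF Gamma_integral_complex[OF pos]])
  have "?f absolutely_integrable_on {0<..}"
    unfolding eq by (rule absolutely_integrable_Gamma_integral'[OF pos])
  then have "(\<lambda>t. norm (?f t)) integrable_on {0<..}"
    by (simp add: absolutely_integrable_on_def)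
  then have h: "(\<lambda>t. norm (?f t)) integrable_on {0..}"
    by (rule integrable_spike_set) (rule negligible_subset[of "{0}"], auto)+
  have "(\<lambda>n. Gamma s - kummer_Gamma s (of_nat n)) \<longlonglongrightarrow> Gamma s"
    using tendsto_integral_half_line[OF F h] unfolding I by simp
  from tendsto_diff[OF tendsto_const[of "Gamma s"] this] show ?thesis by simp
qed

text \<open>
  The points \<open>z + n\<close> and \<open>n\<close> have a fixed distance, and on the disc containing both the derivative decays exponentially.
\<close>
lemma kummer_Gamma_ray_tendsto_0_pos:
  assumes s: "s \<notin> \<int>" and pos: "Re s > 0"
  shows "(\<lambda>n. kummer_Gamma s (z + of_nat n)) \<longlonglongrightarrow> 0"
proof -
  let ?g = "\<lambda>x::real. exp (pi * \<bar>Im (s - 1)\<bar> + norm z) * ((2 * x) powr \<bar>Re (s - 1)\<bar> * exp (- x))"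
  have "(\<lambda>n. kummer_Gamma s (z + of_nat n) - kummer_Gamma s (of_nat n)) \<longlonglongrightarrow> 0"
  proof (rule Lim_null_comparison)
    have "(\<lambda>n. ?g (real n) * norm z) \<longlonglongrightarrow> 0 * norm z"
      by (intro tendsto_mult tendsto_const filterlim_compose[OF powr_exp_tendsto_0[of 1, simplified] filterlim_real_sequentially])
    then show "(\<lambda>n. ?g (real n) * norm z) \<longlonglongrightarrow> 0" by simp
    show "\<forall>\<^sub>F n in sequentially. norm (kummer_Gamma s (z + of_nat n) - kummer_Gamma s (of_nat n)) \<le> ?g (real n) * norm z"
      using eventually_ge_at_top[of "nat \<lceil>norm z + 1\<rceil>"]
    proof eventually_elim
      case (elim n)
      then have n: "real n \<ge> norm z + 1" by linarith
      let ?S = "cball (of_nat n :: complex) (norm z)"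
      have *: "norm (w - of_nat n) \<le> norm z" if "w \<in> ?S" for w
        using that by (simp add: dist_norm norm_minus_commute)
      have "norm (kummer_Gamma s (z + of_nat n) - kummer_Gamma s (of_nat n)) \<le> ?g (real n) * norm (z + of_nat n - of_nat n)"
      proof (rule field_differentiable_bound[of ?S])
        fix w assume w: "w \<in> ?S"
        have "Re w > 0"
          using *[OF w] abs_Re_le_cmod[of "w - of_nat n"] n by simp
        then have "w \<notin> \<real>\<^sub>\<le>\<^sub>0" by (auto simp: complex_nonpos_Reals_iff)
        then show "(kummer_Gamma s has_field_derivative - (w powr (s - 1) * exp (- w))) (at w within ?S)"
          by (rule kummer_Gamma_deriv[OF s])
        show "norm (- (w powr (s - 1) * exp (- w))) \<le> ?g (real n)"
          using Gamma_integrand_bound[OF *[OF w] n, of "s - 1"] by simp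
      qed (auto simp: dist_norm)
      then show ?case by simp
    qed
  qed
  from tendsto_add[OF this kummer_Gamma_real_tendsto_0[OF s pos]] show ?thesis by simp
qed

text \<open>
  Euler's integral is not available for \<open>Re s \<le> 0\<close>, but solving the functional equation for the value at \<open>s\<close>
  lowers the real part by one at the cost of a term that vanishes along the ray.
\<close>
lemma kummer_Gamma_ray_tendsto_0:
  assumes s: "s \<notin> \<int>" and z: "z \<notin> \<real>\<^sub>\<le>\<^sub>0"
  shows "(\<lambda>n. kummer_Gamma s (z + of_nat n)) \<longlonglongrightarrow> 0"
proof -
  have "(\<lambda>n. kummer_Gamma s (z + of_nat n)) \<longlonglongrightarrow> 0" if "s \<notin> \<int>" "Re s + real k > 0" for k s
    using that
  proof (induction k arbitrary: s)
    case 0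
    then show ?case using kummer_Gamma_ray_tendsto_0_pos by simp
  next
    case (Suc k)
    have s0: "s \<noteq> 0" using Suc.prems by auto
    have "s + 1 \<notin> \<int>" using Suc.prems(1) by (metis Ints_1 Ints_diff add_diff_cancel_right')
    then have "(\<lambda>n. kummer_Gamma (s + 1) (z + of_nat n)) \<longlonglongrightarrow> 0"
      using Suc by simp
    from tendsto_diff[OF this powr_exp_ray_tendsto_0[of z s]]
    have "(\<lambda>n. (kummer_Gamma (s + 1) (z + of_nat n) - (z + of_nat n) powr s * exp (- (z + of_nat n))) / s) \<longlonglongrightarrow> (0 - 0) / s"
      by (intro tendsto_divide tendsto_const s0)
    moreover have "z + of_nat n \<noteq> 0" for n
      using shift_notin_nonpos_Reals[OF z, of "real n"] by auto
    ultimately show ?case using kummer_Gamma_plus1[OF Suc.prems(1)] s0 by simp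
  qed
  moreover have "Re s + real (nat \<lceil>1 - Re s\<rceil>) > 0" by linarith
  ultimately show ?thesis using s by blast
qed

text \<open>
  By the fundamental theorem the integral over \<open>[0, n]\<close> is the difference of the closed form at \<open>z\<close> and \<open>z + n\<close>,
  and the second value vanishes in the limit. What needs work is an integrable majorant on the whole
  ray, since \<open>Gamma_integrand_bound\<close> applies only far out.
\<close>
lemma upper_Gamma_eq_kummer_Gamma:
  assumes s: "s \<notin> \<int>" and z: "z \<notin> \<real>\<^sub>\<le>\<^sub>0"
  shows "upper_Gamma s z = kummer_Gamma s z"
proof -
  let ?f = "\<lambda>x::real. (z + of_real x) powr (s - 1) * exp (- (z + of_real x))"
  \<comment> \<open>Half of the exponential decay is spent on absorbing the power, the other half gives the majorant.\<close>
  have "((\<lambda>x::real. exp (pi * \<bar>Im (s - 1)\<bar> + norm z) * ((2 * x) powr \<bar>Re (s - 1)\<bar> * exp (- (x / 2)))) \<longlongrightarrow> 0) at_top"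
    using powr_exp_tendsto_0[of "1/2"] by simp
  then have "eventually (\<lambda>x::real. exp (pi * \<bar>Im (s - 1)\<bar> + norm z) * ((2 * x) powr \<bar>Re (s - 1)\<bar> * exp (- (x / 2))) < 1) at_top"
    by (rule order_tendstoD) simp
  then obtain N where N: "\<And>x. x \<ge> N \<Longrightarrow> exp (pi * \<bar>Im (s - 1)\<bar> + norm z) * ((2 * x) powr \<bar>Re (s - 1)\<bar> * exp (- (x / 2))) < 1"
    by (auto simp: eventually_at_top_linorder)
  define M where "M = max N (norm z + 1)"
  have tail: "norm (?f x) \<le> exp (- (x / 2))" if "x \<ge> M" for x
  proof -
    have "norm (?f x) \<le> exp (pi * \<bar>Im (s - 1)\<bar> + norm z) * ((2 * x) powr \<bar>Re (s - 1)\<bar> * exp (- x))"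
      using that by (intro Gamma_integrand_bound) (auto simp: M_def)
    also have "exp (- x) = exp (- (x / 2)) * exp (- (x / 2))" by (simp add: exp_add[symmetric])
    also have "exp (pi * \<bar>Im (s - 1)\<bar> + norm z) * ((2 * x) powr \<bar>Re (s - 1)\<bar> * (exp (- (x / 2)) * exp (- (x / 2))))
       = (exp (pi * \<bar>Im (s - 1)\<bar> + norm z) * ((2 * x) powr \<bar>Re (s - 1)\<bar> * exp (- (x / 2)))) * exp (- (x / 2))"
      by (simp add: mult_ac)
    also have "\<dots> \<le> 1 * exp (- (x / 2))"
      using N[of x] that by (intro mult_right_mono) (auto simp: M_def)
    finally show ?thesis by simp
  qed
  have "continuous_on {0..M} ?f"
    using shift_notin_nonpos_Reals[OF z]
    by (intro continuous_intros) (force simp: complex_nonpos_Reals_iff | fastforce)+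
  then have "bounded (?f ` {0..M})"
    by (intro compact_imp_bounded compact_continuous_image) auto
  then obtain B where B: "\<And>x. x \<in> {0..M} \<Longrightarrow> norm (?f x) \<le> B" "B > 0"
    unfolding bounded_pos ball_simps by blast
  \<comment> \<open>The factor \<open>e\<^sup>M\<^sup>/\<^sup>2\<close> makes the second summand at least \<open>B\<close> on \<open>[0, M]\<close>, the first one covers the tail.\<close>
  let ?h = "\<lambda>x::real. (1 + B * exp (M / 2)) * exp (- (1 / 2) * x)"
  have h: "?h integrable_on {0..}"
    using integrable_on_cmult_left[OF integrable_on_exp_minus_to_infinity[of "1 / 2" 0], of "1 + B * exp (M / 2)"]
    by (simp del: mult_minus_left)
  have le: "norm (?f x) \<le> ?h x" if "x \<ge> 0" for x
  proof (cases "x \<ge> M")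
    case True
    have "norm (?f x) \<le> 1 * exp (- (1 / 2) * x)" using tail[OF True] by simp
    also have "\<dots> \<le> ?h x" using B(2) by (intro mult_right_mono) auto
    finally show ?thesis .
  next
    case False
    have "norm (?f x) \<le> B * 1" using B(1)[of x] that False by simp
    also have "\<dots> \<le> B * exp (M / 2 - x / 2)"
      using B(2) False by (intro mult_left_mono) auto
    also have "\<dots> = B * exp (M / 2) * exp (- (1 / 2) * x)" by (simp flip: exp_add)
    also have "\<dots> \<le> ?h x" by (intro mult_right_mono) auto
    finally show ?thesis .
  qed
  have "(?f has_integral (kummer_Gamma s z - kummer_Gamma s (z + of_nat n))) {0..real n}" for n
    using kummer_Gamma_has_integral_ray[OF s z, of "real n"] by simp
  from tendsto_integral_half_line[OF this h le]
  have "(\<lambda>n. kummer_Gamma s z - kummer_Gamma s (z + of_nat n)) \<longlonglongrightarrow> upper_Gamma s z"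
    unfolding upper_Gamma_def .
  moreover have "(\<lambda>n. kummer_Gamma s z - kummer_Gamma s (z + of_nat n)) \<longlonglongrightarrow> kummer_Gamma s z - 0"
    by (intro tendsto_diff tendsto_const kummer_Gamma_ray_tendsto_0[OF s z])
  ultimately show ?thesis using LIMSEQ_unique by fastforce
qed

section \<open>The expansion\<close>

theorem corollary4p3:
  fixes s p \<theta> z :: complex
  assumes "s \<notin> \<int>"
    and "z \<noteq> 0"
    and "\<theta> = 0 \<or> norm z < 1 / norm \<theta>"
    and "Arg (1 - \<theta> * z) \<in> {- pi<..<pi}"
    and "Arg z \<in> {- pi<..<pi}"
  shows "summable (\<lambda>n. v_coeff s p \<theta> n * z ^ n) \<and>
         summable (\<lambda>n. w_coeff s p \<theta> n * z powr (of_nat n + s)) \<and>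
         (1 - \<theta> * z) powr p * upper_Gamma s z =
           (\<Sum>n. v_coeff s p \<theta> n * z ^ n)
         + (\<Sum>n. w_coeff s p \<theta> n * z powr (of_nat n + s))"
proof -
  define A where "A = binomial_series p \<theta>"
  define Y where "Y = kummer_series s"
  define W where "W = fps_exp (- 1) * (A * Y)"
  have z: "z \<notin> \<real>\<^sub>\<le>\<^sub>0"
    using assms(2,5) Arg_eq_pi[of z] by (auto simp: complex_nonpos_Reals_iff complex_eq_iff)
  have rA: "norm z < fps_conv_radius A" and eA: "eval_fps A z = (1 - \<theta> * z) powr p"
    unfolding A_def using binomial_series_disc[OF assms(3)] by auto
  have rY: "norm z < fps_conv_radius Y"
    by (simp add: Y_def kummer_series_conv_radius[OF assms(1)])
  have rAY: "norm z < fps_conv_radius (A * Y)"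
    using rA rY fps_conv_radius_mult[of A Y] by (metis min_less_iff_conj order_less_le_trans)
  have rE: "norm z < fps_conv_radius (fps_exp (- 1 :: complex))" by simp
  have rW: "norm z < fps_conv_radius W"
    unfolding W_def using rAY rE fps_conv_radius_mult[of "fps_exp (- 1)" "A * Y"]
    by (metis min_less_iff_conj order_less_le_trans)
  have eW: "eval_fps W z = exp (- z) * ((1 - \<theta> * z) powr p * eval_fps Y z)"
    unfolding W_def by (simp add: eval_fps_mult rA rY rAY eA)
  have v: "(\<lambda>n. v_coeff s p \<theta> n * z ^ n) sums (Gamma s * (1 - \<theta> * z) powr p)"
    using sums_mult[OF sums_eval_fps[OF rA], of "Gamma s"]
    by (simp add: v_coeff_eq[OF assms(1)] A_def[symmetric] eA mult.assoc)
  have "w_coeff s p \<theta> n * z powr (of_nat n + s) = - (z powr s / s) * (fps_nth W n * z ^ n)" for n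
    using assms(2) by (simp add: w_coeff_eq[OF assms(1)] W_def A_def Y_def powr_add)
  then have w: "(\<lambda>n. w_coeff s p \<theta> n * z powr (of_nat n + s)) sums (- (z powr s / s) * eval_fps W z)"
    using sums_mult[OF sums_eval_fps[OF rW], of "- (z powr s / s)"] by simp
  have "(1 - \<theta> * z) powr p * upper_Gamma s z
      = Gamma s * (1 - \<theta> * z) powr p + - (z powr s / s) * eval_fps W z"
    unfolding upper_Gamma_eq_kummer_Gamma[OF assms(1) z] kummer_Gamma_def eW Y_def
    by (simp add: algebra_simps)
  then show ?thesis
    using v w sums_unique[OF v] sums_unique[OF w] by (auto simp: sums_iff)
qed

end
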